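(* For every positive semi-definite matrix in $\mathbb{M}_{n+m}^+$ written in blocks as $\begin{bmatrix} A &X \\ X^* &B\end{bmatrix}$ with $A\in\mathbb{M}_n^+$, $B\in\mathbb{M}_m^+$, there exist unitaries $U,V\in \mathbb{M}_{n+m}$ such that $$\begin{bmatrix} A &X \\ X^* &B\end{bmatrix} = U\begin{bmatrix} A &0 \\ 0 &0\end{bmatrix} U^* + V\begin{bmatrix} 0 &0 \\ 0 &B\end{bmatrix} V^*.$$
   Context: $\mathbb{M}_k$ is the algebra of complex $k\times k$ matrices and $\mathbb{M}_k^+$ is the set of positive semi-definite matrices in it. All block matrices are partitioned with diagonal blocks of sizes $n$ and $m$. *)

theory Defs
  imports "Jordan_Normal_Form.Schur_Decomposition"
begin

(* The form below is v^* A v; in the order on the complex numbers, 0 <= z says that z is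
   real and nonnegative. *)
definition psd_mats :: "nat \<Rightarrow> complex mat set" where
  "psd_mats k = {A \<in> carrier_mat k k. mat_adjoint A = A \<and>
     (\<forall>v \<in> carrier_vec k. 0 \<le> (A *\<^sub>v v) \<bullet>c v)}"

definition unitary_mats :: "nat \<Rightarrow> complex mat set" where
  "unitary_mats k = {U \<in> carrier_mat k k.
     mat_adjoint U * U = 1\<^sub>m k \<and> U * mat_adjoint U = 1\<^sub>m k}"

end

theory Submission
  imports Defs
begin

text \<open>
  Write the given matrix as \<open>M = R R\<close> with \<open>R\<close> Hermitian, and let \<open>E\<close>, \<open>F\<close> be the complementary
  block projections. Then \<open>M = R E R + R F R\<close>. With \<open>T = R E\<close> we have \<open>R E R = T T\<^sup>*\<close>, while
  \<open>T\<^sup>* T = E M E = A \<oplus> 0\<close>; and \<open>T T\<^sup>*\<close> and \<open>T\<^sup>* T\<close> are unitarily similar, being Hermitian with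
  the same characteristic polynomial. The same applies to \<open>F\<close> and \<open>B\<close>.
\<close>

section \<open>Algebra of the adjoint\<close>

lemma dim_mat_adjoint [simp]:
  "dim_row (mat_adjoint A) = dim_col A" "dim_col (mat_adjoint A) = dim_row A"
  by (simp_all add: mat_adjoint_def)

lemma mat_adjoint_carrier [simp]: "A \<in> carrier_mat n m \<Longrightarrow> mat_adjoint A \<in> carrier_mat m n"
  by (metis carrier_matD carrier_matI dim_mat_adjoint)

lemma index_mat_adjoint [simp]:
  "i < dim_col A \<Longrightarrow> j < dim_row A \<Longrightarrow> mat_adjoint A $$ (i, j) = conjugate (A $$ (j, i))"
  by (simp add: mat_adjoint_def mat_of_rows_index)

lemma mat_adjoint_adjoint [simp]: "mat_adjoint (mat_adjoint A) = A"
  by (rule eq_matI) auto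

lemma mat_adjoint_one [simp]: "mat_adjoint (1\<^sub>m n :: complex mat) = 1\<^sub>m n"
  by (rule eq_matI) auto

lemma mat_adjoint_zero [simp]: "mat_adjoint (0\<^sub>m n m :: complex mat) = 0\<^sub>m m n"
  by (rule eq_matI) auto

lemma mat_adjoint_mult:
  assumes "A \<in> carrier_mat n m" "B \<in> carrier_mat m k"
  shows "mat_adjoint (A * B) = mat_adjoint B * mat_adjoint A"
  using assms
  by (intro eq_matI)
     (auto simp: scalar_prod_def sum_conjugate conjugate_dist_mul mult.commute intro!: sum.cong)

lemma mat_adjoint_four_block:
  assumes "A \<in> carrier_mat n1 m1" "B \<in> carrier_mat n1 m2"
    and "C \<in> carrier_mat n2 m1" "D \<in> carrier_mat n2 m2"
  shows "mat_adjoint (four_block_mat A B C D) =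
    four_block_mat (mat_adjoint A) (mat_adjoint C) (mat_adjoint B) (mat_adjoint D)"
  using assms by (intro eq_matI) auto

text \<open>Unlike \<open>mult_carrier_mat\<close>, this can be discharged by the simplifier, as
no inner dimension has to be guessed.\<close>

lemma mult_square_carrier [simp]:
  "A \<in> carrier_mat k k \<Longrightarrow> B \<in> carrier_mat k k \<Longrightarrow> A * B \<in> carrier_mat k k"
  by simp

text \<open>The bridge between vectors and matrices: it carries orthonormality of columns into
  \<open>mat_adjoint U * U = 1\<^sub>m k\<close>, and values of the quadratic form into diagonal
  entries. The column of \<open>B\<close> comes first because \<open>\<bullet>c\<close> conjugates
  its right argument.\<close>

lemma mat_adjoint_mult_index:
  assumes "A \<in> carrier_mat n m" "B \<in> carrier_mat n k" "i < m" "j < k"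
  shows "(mat_adjoint A * B) $$ (i, j) = col B j \<bullet>c col A i"
  using assms by (auto simp: scalar_prod_def mult.commute intro!: sum.cong)

section \<open>Unitary matrices\<close>

lemma unitary_matsD:
  assumes "U \<in> unitary_mats k"
  shows "U \<in> carrier_mat k k" "mat_adjoint U * U = 1\<^sub>m k" "U * mat_adjoint U = 1\<^sub>m k"
  using assms by (auto simp: unitary_mats_def)

text \<open>A one-sided inverse of a square matrix is two-sided, so orthonormality of the columns
  suffices.\<close>

lemma unitary_matsI:
  assumes "U \<in> carrier_mat k k" "mat_adjoint U * U = 1\<^sub>m k"
  shows "U \<in> unitary_mats k"
  using assms mat_mult_left_right_inverse[of "mat_adjoint U" k U] by (auto simp: unitary_mats_def)

lemma unitary_mats_adjoint: "U \<in> unitary_mats k \<Longrightarrow> mat_adjoint U \<in> unitary_mats k"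
  by (auto simp: unitary_mats_def)

lemma mult_cancel_middle:
  fixes U U' :: "'a :: semiring_1 mat"
  assumes "A \<in> carrier_mat n k" "U \<in> carrier_mat k k" "U' \<in> carrier_mat k k"
    and "B \<in> carrier_mat k m" "U * U' = 1\<^sub>m k"
  shows "A * U * (U' * B) = A * B"
proof -
  have "A * U * (U' * B) = A * (U * U' * B)"
    using assms(1-4) by (simp add: assoc_mult_mat[of _ n k _ k _ m] assoc_mult_mat[of _ k k _ k _ m])
  with assms show ?thesis by simp
qed

lemma unitary_mats_mult:
  assumes "U \<in> unitary_mats k" "V \<in> unitary_mats k"
  shows "U * V \<in> unitary_mats k"
proof (rule unitary_matsI)
  note U = unitary_matsD[OF assms(1)] and V = unitary_matsD[OF assms(2)]
  show "U * V \<in> carrier_mat k k" using U V by auto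
  have "mat_adjoint (U * V) * (U * V) = mat_adjoint V * mat_adjoint U * (U * V)"
    using mat_adjoint_mult[OF U(1) V(1)] by simp
  also have "\<dots> = mat_adjoint V * V"
    using U V by (intro mult_cancel_middle) auto
  finally show "mat_adjoint (U * V) * (U * V) = 1\<^sub>m k" using V by simp
qed

section \<open>Characteristic polynomials of block triangular matrices and of products\<close>

text \<open>The characteristic matrix inherits the zero upper right block, and the determinant of a
  block triangular matrix is the product of the determinants of its diagonal blocks.\<close>

lemma char_poly_four_block_upper_right_zero:
  fixes A :: "'a :: idom mat"
  assumes "A \<in> carrier_mat n n" "C \<in> carrier_mat m n" "D \<in> carrier_mat m m"
  shows "char_poly (four_block_mat A (0\<^sub>m n m) C D) = char_poly A * char_poly D"
proof -
  have "char_poly_matrix (four_block_mat A (0\<^sub>m n m) C D) =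
      four_block_mat (char_poly_matrix A) (0\<^sub>m n m) (map_mat (\<lambda>a. [:- a:]) C) (char_poly_matrix D)"
    using assms by (intro eq_matI) (auto simp: char_poly_matrix_def one_poly_def)
  then show ?thesis
    unfolding char_poly_def using assms
    by (simp add: det_four_block_mat_upper_right_zero[OF _ refl])
qed

text \<open>\<open>[AB 0; B 0]\<close> and \<open>[0 0; B BA]\<close> are conjugate under \<open>[1 A; 0 1]\<close>.\<close>

lemma char_poly_mult_commute:
  fixes A B :: "'a :: idom mat"
  assumes A: "A \<in> carrier_mat n n" and B: "B \<in> carrier_mat n n"
  shows "char_poly (A * B) = char_poly (B * A)"
proof -
  let ?Z = "0\<^sub>m n n :: 'a mat" and ?I = "1\<^sub>m n :: 'a mat"
  let ?L = "four_block_mat (A * B) ?Z B ?Z" and ?R = "four_block_mat ?Z ?Z B (B * A)"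
  let ?P = "four_block_mat ?I A ?Z ?I" and ?Q = "four_block_mat ?I (- A) ?Z ?I"
  have AB: "A * B \<in> carrier_mat n n" and BA: "B * A \<in> carrier_mat n n" using A B by auto
  have [simp]: "- ?Z = ?Z" by (rule eq_matI) auto
  have [simp]: "A + - A = ?Z" using A by (auto intro!: eq_matI)
  have PQ: "?P * ?Q = 1\<^sub>m (n + n)"
    using A by (subst mult_four_block_mat[where ?nc1.0 = n and ?nc2.0 = n]) auto
  have "?P * ?R = four_block_mat (A * B) (A * (B * A)) B (B * A)"
    using A B BA by (subst mult_four_block_mat[where ?nc1.0 = n and ?nc2.0 = n]) auto
  moreover have "?L * ?P = four_block_mat (A * B) (A * (B * A)) B (B * A)"
    using A B AB by (subst mult_four_block_mat[where ?nc1.0 = n and ?nc2.0 = n]) auto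
  ultimately have "?P * ?R = ?L * ?P" by simp
  then have "?P * ?R * ?Q = ?L * (?P * ?Q)"
    using A B AB BA by (simp add: assoc_mult_mat[of _ "n+n" "n+n" _ "n+n" _ "n+n"])
  then have L: "?P * ?R * ?Q = ?L"
    unfolding PQ using AB by (simp add: right_mult_one_mat[of _ "n + n" "n + n"])
  have QP: "?Q * ?P = 1\<^sub>m (n + n)"
    using A by (subst mult_four_block_mat[where ?nc1.0 = n and ?nc2.0 = n]) auto
  have "similar_mat ?L ?R"
    by (rule similar_matI[OF _ PQ QP L[symmetric]]) (use AB BA A in auto)
  then have "char_poly ?L = char_poly ?R" by (rule char_poly_similar)
  moreover have "char_poly ?L = char_poly (A * B) * char_poly ?Z"
    by (rule char_poly_four_block_upper_right_zero) (use AB B in simp_all)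
  moreover have "char_poly ?R = char_poly ?Z * char_poly (B * A)"
    by (rule char_poly_four_block_upper_right_zero) (use BA B in simp_all)
  \<comment> \<open>A monic polynomial is nonzero, so over an integral domain the common factor
    \<open>char_poly ?Z\<close> can be cancelled.\<close>
  moreover have "char_poly ?Z \<noteq> 0"
    using degree_monic_char_poly[of ?Z n] by auto
  ultimately show ?thesis by simp
qed

section \<open>Unitary diagonalization of Hermitian matrices\<close>

text \<open>Completing \<open>v\<close> to a basis and orthogonalizing gives orthogonal columns
  starting with \<open>v\<close>; normalizing them makes the matrix unitary. This supplies the
  change of basis that puts an eigenvector first.\<close>

lemma unitary_mat_with_first_col:
  fixes v :: "complex vec"
  assumes v: "v \<in> carrier_vec n" and v0: "v \<noteq> 0\<^sub>v n"
  obtains W c where "W \<in> unitary_mats n" "col W 0 = c \<cdot>\<^sub>v v"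
proof -
  interpret cof_vec_space n "TYPE(complex)" .
  define b where "b = basis_completion v"
  note b = basis_completion[OF v v0, folded b_def]
  define ws where "ws = gram_schmidt n b"
  have n: "n \<noteq> 0" using v v0 by (auto intro!: eq_vecI)
  from b(6,7) n obtain vs where bv: "b = v # vs" by (cases b) auto
  have ws: "corthogonal ws" "set ws \<subseteq> carrier_vec n" "length ws = n"
    using gram_schmidt_result[OF b(2,4,5) ws_def] b(6) by auto
  have "hd ws = v" unfolding ws_def bv by (rule gram_schmidt_hd[OF v])
  then have ws0: "ws ! 0 = v" using ws(3) n by (cases ws) auto
  \<comment> \<open>The reciprocal norm of \<open>w\<close>, since \<open>gram_schmidt\<close>
    orthogonalizes without normalizing. Being real, it passes through conjugation unchanged.\<close>
  define f where "f w = complex_of_real (1 / sqrt (Re (w \<bullet>c w)))" for w :: "complex vec"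
  define W where "W = mat_of_cols n (map (\<lambda>w. f w \<cdot>\<^sub>v w) ws)"
  have wc: "ws ! i \<in> carrier_vec n" if "i < n" for i using ws(2,3) that by auto
  have W: "W \<in> carrier_mat n n" unfolding W_def using ws(3) by auto
  have colW: "col W i = f (ws ! i) \<cdot>\<^sub>v ws ! i" if "i < n" for i
    unfolding W_def using that ws(3) wc by (subst col_mat_of_cols) auto
  have "mat_adjoint W * W = 1\<^sub>m n"
  proof (rule eq_matI)
    fix i j assume "i < dim_row (1\<^sub>m n :: complex mat)" "j < dim_col (1\<^sub>m n :: complex mat)"
    then have i: "i < n" and j: "j < n" by auto
    let ?x = "ws ! i" and ?y = "ws ! j"
    have "(mat_adjoint W * W) $$ (i, j) = (f ?y \<cdot>\<^sub>v ?y) \<bullet>c (f ?x \<cdot>\<^sub>v ?x)"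
      by (simp only: mat_adjoint_mult_index[OF W W i j] colW i j)
    also have "\<dots> = f ?y * f ?x * (?y \<bullet>c ?x)"
      using wc[OF i] wc[OF j] by (simp add: conjugate_smult_vec f_def)
    also have "\<dots> = (1\<^sub>m n :: complex mat) $$ (i, j)"
    proof (cases "i = j")
      case False
      then have "?y \<bullet>c ?x = 0" using corthogonalD[OF ws(1), of j i] i j ws(3) by auto
      with False i j show ?thesis by simp
    next
      case True
      \<comment> \<open>\<open>corthogonal\<close> also says that no vector of the list is
        orthogonal to itself; with nonnegativity this makes \<open>?x \<bullet>c ?x\<close> a
        positive real, so its root can be inverted.\<close>
      have "?x \<bullet>c ?x \<noteq> 0" using corthogonalD[OF ws(1), of i i] i ws(3) by auto
      moreover have "0 \<le> ?x \<bullet>c ?x" by (rule conjugate_square_ge_0_vec)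
      ultimately have "?x \<bullet>c ?x = of_real (Re (?x \<bullet>c ?x))" "Re (?x \<bullet>c ?x) > 0"
        by (auto simp: less_eq_complex_def complex_eq_iff)
      moreover have "1 / sqrt q * (1 / sqrt q) * q = 1" if "q > 0" for q :: real
        using that by (simp add: field_simps)
      ultimately have "f ?x * f ?x * (?x \<bullet>c ?x) = 1"
        unfolding f_def by (metis of_real_1 of_real_mult)
      then show ?thesis using True i by simp
    qed
    finally show "(mat_adjoint W * W) $$ (i, j) = (1\<^sub>m n :: complex mat) $$ (i, j)" .
  qed (use W in auto)
  then have "W \<in> unitary_mats n" by (rule unitary_matsI[OF W])
  moreover have "col W 0 = f v \<cdot>\<^sub>v v" using colW[of 0] n ws0 by simp
  ultimately show ?thesis by (rule that)
qed


text \<open>Deflation, by induction on the list of eigenvalues: split off an eigenvector for the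
  first one and continue with the Hermitian block on its orthogonal complement. Fixing the order of
  the diagonal by \<open>es\<close> lets two matrices with equal characteristic polynomials be
  diagonalized to the same matrix.\<close>

lemma hermitian_diagonalization:
  fixes A :: "complex mat"
  assumes "A \<in> carrier_mat n n" "mat_adjoint A = A"
    and "char_poly A = (\<Prod>e\<leftarrow>es. [:- e, 1:])"
  shows "\<exists>W \<in> unitary_mats n. A = W * mat_diag n ((!) es) * mat_adjoint W"
  using assms
proof (induction es arbitrary: n A)
  case Nil
  then have "n = 0" using degree_monic_char_poly[OF Nil(1)] by simp
  with Nil show ?case
    by (intro bexI[of _ "1\<^sub>m 0"]) (auto simp: unitary_mats_def)
next
  case (Cons e es n A)
  note A = Cons.prems(1) and herm = Cons.prems(2) and cp = Cons.prems(3)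
  have "eigenvalue A e"
    unfolding eigenvalue_root_char_poly[OF A] cp by simp
  then obtain v where v: "v \<in> carrier_vec n" "v \<noteq> 0\<^sub>v n" and Av: "A *\<^sub>v v = e \<cdot>\<^sub>v v"
    using A unfolding eigenvalue_def eigenvector_def by auto
  have "n \<noteq> 0" using v by (metis carrier_vecD eq_vecI index_zero_vec(2) less_nat_zero_code)
  then obtain k where n: "n = Suc k" by (cases n) auto
  obtain W c where Wu: "W \<in> unitary_mats n" and col0: "col W 0 = c \<cdot>\<^sub>v v"
    using unitary_mat_with_first_col[OF v] .
  note W = unitary_matsD[OF Wu]
  \<comment> \<open>\<open>A\<close> in the basis of the columns of \<open>W\<close>. As the first
    of these is an eigenvector, the first column of \<open>B\<close> is \<open>e\<close> times the
    first unit vector.\<close>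
  define B where "B = mat_adjoint W * (A * W)"
  have B: "B \<in> carrier_mat n n" unfolding B_def using A W by auto
  have colAW: "col (A * W) 0 = e \<cdot>\<^sub>v col W 0"
  proof -
    have "col (A * W) 0 = A *\<^sub>v (c \<cdot>\<^sub>v v)"
      unfolding col0[symmetric] by (rule col_mult2[OF A W(1)]) (use n in simp)
    also have "\<dots> = e \<cdot>\<^sub>v (c \<cdot>\<^sub>v v)"
      using A v(1) Av by (simp add: mult_mat_vec smult_smult_assoc mult.commute)
    finally show ?thesis by (simp add: col0)
  qed
  have Bherm: "mat_adjoint B = B"
  proof -
    have "mat_adjoint B = mat_adjoint (A * W) * mat_adjoint (mat_adjoint W)"
      unfolding B_def using A W(1) by (intro mat_adjoint_mult) auto
    also have "\<dots> = mat_adjoint W * A * W"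
      using A W(1) herm by (simp add: mat_adjoint_mult)
    finally show ?thesis
      unfolding B_def using A W(1) by (simp add: assoc_mult_mat[of _ n n _ n _ n])
  qed
  have Bcol: "B $$ (i, 0) = (if i = 0 then e else 0)" if i: "i < n" for i
  proof -
    have "B $$ (i, 0) = (e \<cdot>\<^sub>v col W 0) \<bullet>c col W i"
      unfolding B_def using A W(1) i n
      by (subst mat_adjoint_mult_index[of _ n n _ n]) (simp_all only: colAW, auto)
    also have "\<dots> = e * (col W 0 \<bullet>c col W i)"
      using W(1) by simp
    also have "col W 0 \<bullet>c col W i = (mat_adjoint W * W) $$ (i, 0)"
      using i n by (subst mat_adjoint_mult_index[OF W(1) W(1)]) auto
    finally show ?thesis using W(2) i n by auto
  qed
  \<comment> \<open>Hermitian symmetry carries the zeros of the first column over to the first row,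
    so \<open>B\<close> splits into the blocks \<open>?E\<close> and \<open>C\<close>.\<close>
  have Brow: "B $$ (0, i) = (if i = 0 then e else 0)" if i: "i < n" for i
  proof (cases "i = 0")
    case False
    have "B $$ (0, i) = conjugate (B $$ (i, 0))"
      using B i n by (subst Bherm[symmetric], subst index_mat_adjoint) auto
    with False show ?thesis using Bcol[OF i] by simp
  qed (use Bcol i in simp)
  define C where "C = mat k k (\<lambda>(i, j). B $$ (Suc i, Suc j))"
  have C: "C \<in> carrier_mat k k" unfolding C_def by simp
  let ?E = "mat 1 1 (\<lambda>_. e)"
  have Bblock: "B = four_block_mat ?E (0\<^sub>m 1 k) (0\<^sub>m k 1) C"
    using B n Bcol Brow unfolding C_def by (intro eq_matI) auto
  have Cherm: "mat_adjoint C = C"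
  proof (rule eq_matI)
    fix i j assume "i < dim_row C" "j < dim_col C"
    then have "i < k" "j < k" using C by auto
    then show "mat_adjoint C $$ (i, j) = C $$ (i, j)"
      using B n arg_cong[OF Bherm, of "\<lambda>M. M $$ (Suc i, Suc j)"] by (simp add: C_def)
  qed (use C in auto)
  have A_eq: "A = W * B * mat_adjoint W"
  proof -
    have "W * B * mat_adjoint W = W * mat_adjoint W * (A * (W * mat_adjoint W))"
      unfolding B_def using A W(1) by (simp add: assoc_mult_mat[of _ n n _ n _ n])
    then show ?thesis using A W by simp
  qed
  have "similar_mat A B"
    by (rule similar_matI[OF _ W(3,2) A_eq]) (use A B W in auto)
  then have "char_poly A = char_poly B" by (rule char_poly_similar)
  also have "\<dots> = char_poly ?E * char_poly C"
    unfolding Bblock by (rule char_poly_four_block_zeros_col) (use C in auto)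
  also have "char_poly ?E = [:- e, 1:]"
    by (simp add: char_poly_defs det_single)
  finally have "[:- e, 1:] * char_poly C = [:- e, 1:] * (\<Prod>e\<leftarrow>es. [:- e, 1:])"
    using cp by simp
  \<comment> \<open>Cancelling the nonzero linear factor of \<open>e\<close> leaves exactly the list
    \<open>es\<close> for \<open>C\<close>, as the induction hypothesis requires.\<close>
  then have "char_poly C = (\<Prod>e\<leftarrow>es. [:- e, 1:])"
    by (subst (asm) mult_cancel_left) auto
  from Cons.IH[OF C Cherm this] obtain Y where Yu: "Y \<in> unitary_mats k"
    and C_eq: "C = Y * mat_diag k ((!) es) * mat_adjoint Y" by auto
  note Y = unitary_matsD[OF Yu]
  let ?D = "mat_diag k ((!) es)"
  \<comment> \<open>Extending \<open>Y\<close> by the identity on the split-off direction turns the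
    diagonalization of \<open>C\<close> into one of \<open>B\<close>.\<close>
  let ?Y = "four_block_mat (1\<^sub>m 1) (0\<^sub>m 1 k) (0\<^sub>m k 1) Y"
  have Yc: "?Y \<in> carrier_mat n n"
    unfolding n using four_block_carrier_mat[OF one_carrier_mat Y(1), of 1] by simp
  have adjY: "mat_adjoint ?Y = four_block_mat (1\<^sub>m 1) (0\<^sub>m 1 k) (0\<^sub>m k 1) (mat_adjoint Y)"
    using Y by (simp add: mat_adjoint_four_block[of _ 1 1 _ k _ k])
  have D: "mat_diag n ((!) (e # es)) = four_block_mat ?E (0\<^sub>m 1 k) (0\<^sub>m k 1) ?D"
    unfolding n by (intro eq_matI) (auto simp: mat_diag_def nth_Cons split: nat.splits)
  have "mat_adjoint ?Y * ?Y = 1\<^sub>m n"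
    unfolding adjY n using Y
    by (subst mult_four_block_mat[where ?nc1.0 = 1 and ?nc2.0 = k]) auto
  then have Yu: "?Y \<in> unitary_mats n" using Yc by (intro unitary_matsI)
  have B_eq: "B = ?Y * mat_diag n ((!) (e # es)) * mat_adjoint ?Y"
  proof -
    let ?D' = "four_block_mat ?E (0\<^sub>m 1 k) (0\<^sub>m k 1) (Y * ?D)"
    have "?Y * mat_diag n ((!) (e # es)) = ?D'"
      unfolding D using Y
      by (subst mult_four_block_mat[where ?nc1.0 = 1 and ?nc2.0 = k])
         (auto simp: left_mult_zero_mat[of _ k k])
    moreover have "?D' * mat_adjoint ?Y = B"
      unfolding adjY Bblock C_eq using Y
      by (subst mult_four_block_mat[where ?nc1.0 = 1 and ?nc2.0 = k])
         (auto simp: right_mult_zero_mat[of _ k k])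
    ultimately show ?thesis by simp
  qed
  have "A = W * ?Y * mat_diag n ((!) (e # es)) * mat_adjoint (W * ?Y)"
    unfolding A_eq B_eq mat_adjoint_mult[OF W(1) Yc] using W(1) Yc
    by (simp add: assoc_mult_mat[of _ n n _ n _ n] del: nth_Cons)
  with unitary_mats_mult[OF Wu Yu] show ?case by blast
qed

section \<open>Consequences of diagonalization: unitary similarity and square roots\<close>

text \<open>Equal characteristic polynomials let both products be diagonalized to one matrix, with
  the eigenvalues in the same order; the unitary maps one eigenbasis to the other.\<close>

lemma mult_adjoint_unitarily_similar:
  fixes T :: "complex mat"
  assumes T: "T \<in> carrier_mat k k"
  shows "\<exists>U \<in> unitary_mats k. T * mat_adjoint T = U * (mat_adjoint T * T) * mat_adjoint U"
proof -
  let ?S = "mat_adjoint T"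
  have S: "?S \<in> carrier_mat k k" using T by simp
  have TS: "T * ?S \<in> carrier_mat k k" "mat_adjoint (T * ?S) = T * ?S"
    and ST: "?S * T \<in> carrier_mat k k" "mat_adjoint (?S * T) = ?S * T"
    using mat_adjoint_mult[OF T S] mat_adjoint_mult[OF S T] T by auto
  obtain es where es: "char_poly (T * ?S) = (\<Prod>e\<leftarrow>es. [:- e, 1:])"
    using char_poly_factorized[OF TS(1)] by auto
  let ?D = "mat_diag k ((!) es)"
  obtain V where Vu: "V \<in> unitary_mats k" and TS_eq: "T * ?S = V * ?D * mat_adjoint V"
    using hermitian_diagonalization[OF TS es] by auto
  obtain W where Wu: "W \<in> unitary_mats k" and ST_eq: "?S * T = W * ?D * mat_adjoint W"
    using hermitian_diagonalization[OF ST] es char_poly_mult_commute[OF T S] by auto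
  note V = unitary_matsD[OF Vu] and W = unitary_matsD[OF Wu]
  \<comment> \<open>Conjugation by \<open>mat_adjoint W\<close> brings \<open>?S * T\<close> to
    \<open>?D\<close>, and conjugation by \<open>V\<close> then brings \<open>?D\<close> to
    \<open>T * ?S\<close>.\<close>
  let ?U = "V * mat_adjoint W"
  have D: "?D \<in> carrier_mat k k" by simp
  have "?U * (?S * T) * mat_adjoint ?U =
      V * ((mat_adjoint W * W) * (?D * ((mat_adjoint W * W) * mat_adjoint V)))"
    using V(1) W(1) D unfolding ST_eq
    by (simp add: mat_adjoint_mult[of _ k k _ k] assoc_mult_mat[of _ k k _ k _ k])
  also have "\<dots> = T * ?S"
    unfolding W(2) TS_eq using V(1) D
    by (simp add: left_mult_one_mat[of _ k k] assoc_mult_mat[of _ k k _ k _ k])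
  finally show ?thesis
    using unitary_mats_mult[OF Vu unitary_mats_adjoint[OF Wu]] by metis
qed

text \<open>Take square roots of the eigenvalues in a unitary diagonalization; positivity of the
  form makes the eigenvalues nonnegative, so the roots are real and the result is Hermitian.\<close>

lemma psd_mats_square_root:
  assumes "M \<in> psd_mats k"
  obtains R where "R \<in> carrier_mat k k" "mat_adjoint R = R" "M = R * R"
proof -
  have M: "M \<in> carrier_mat k k" "mat_adjoint M = M"
    and pos: "\<And>v. v \<in> carrier_vec k \<Longrightarrow> 0 \<le> (M *\<^sub>v v) \<bullet>c v"
    using assms by (auto simp: psd_mats_def)
  obtain es where es: "char_poly M = (\<Prod>e\<leftarrow>es. [:- e, 1:])"
    using char_poly_factorized[OF M(1)] by auto
  let ?D = "mat_diag k ((!) es)"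
  obtain W where Wu: "W \<in> unitary_mats k" and M_eq: "M = W * ?D * mat_adjoint W"
    using hermitian_diagonalization[OF M es] by auto
  note W = unitary_matsD[OF Wu]
  have D: "?D \<in> carrier_mat k k" by simp
  \<comment> \<open>Solving for \<open>?D\<close> exhibits each eigenvalue as the value of the
    quadratic form of \<open>M\<close> at a column of \<open>W\<close>.\<close>
  have D_eq: "?D = mat_adjoint W * (M * W)"
  proof -
    have "mat_adjoint W * (M * W) = (mat_adjoint W * W) * (?D * (mat_adjoint W * W))"
      unfolding M_eq using W(1) D by (simp add: assoc_mult_mat[of _ k k _ k _ k])
    then show ?thesis unfolding W(2) using D by simp
  qed
  have es_nonneg: "0 \<le> es ! i" if i: "i < k" for i
  proof -
    have "es ! i = ?D $$ (i, i)" using i by (simp add: mat_diag_def)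
    also have "\<dots> = col (M * W) i \<bullet>c col W i"
      unfolding D_eq using M(1) W(1) i by (intro mat_adjoint_mult_index) auto
    also have "col (M * W) i = M *\<^sub>v col W i"
      using M(1) W(1) i by auto
    finally show ?thesis using pos[of "col W i"] W(1) i by simp
  qed
  \<comment> \<open>The order on the complex numbers makes \<open>es ! i\<close> real, so
    \<open>Re\<close> loses nothing.\<close>
  let ?s = "\<lambda>i. complex_of_real (sqrt (Re (es ! i)))"
  let ?Q = "mat_diag k ?s"
  let ?R = "W * ?Q * mat_adjoint W"
  have Q: "?Q \<in> carrier_mat k k" by simp
  have Qherm: "mat_adjoint ?Q = ?Q"
    by (intro eq_matI) (auto simp: mat_diag_def)
  have "?s i * ?s i = es ! i" if "i < k" for i
    using es_nonneg[OF that] by (auto simp: less_eq_complex_def complex_eq_iff)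
  then have QQ: "?Q * ?Q = ?D"
    unfolding mat_diag_diag by (intro eq_matI) (auto simp: mat_diag_def)
  show ?thesis
  proof (rule that)
    show "?R \<in> carrier_mat k k" using W(1) Q by auto
    show "mat_adjoint ?R = ?R"
      using W(1) Q Qherm
      by (simp add: mat_adjoint_mult[of _ k k _ k] assoc_mult_mat[of _ k k _ k _ k])
    have "?R * ?R = W * (?Q * ((mat_adjoint W * W) * (?Q * mat_adjoint W)))"
      using W(1) Q by (simp add: assoc_mult_mat[of _ k k _ k _ k] del: mat_diag_diag)
    also have "\<dots> = W * (?Q * ?Q) * mat_adjoint W"
      unfolding W(2) using W(1) Q
      by (simp add: left_mult_one_mat[of _ k k] assoc_mult_mat[of _ k k _ k _ k] del: mat_diag_diag)
    finally show "M = ?R * ?R" unfolding QQ M_eq by simp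
  qed
qed

section \<open>Splitting along complementary projections\<close>

text \<open>The similarity for \<open>T = R * E\<close> with a general orthogonal projection
  \<open>E\<close>, so that it serves both diagonal blocks. Idempotence reduces the inner
  \<open>E * E\<close> to \<open>E\<close>.\<close>

lemma square_root_compression:
  fixes R :: "complex mat"
  assumes R: "R \<in> carrier_mat k k" "mat_adjoint R = R"
    and E: "E \<in> carrier_mat k k" "mat_adjoint E = E" "E * E = E"
  shows "\<exists>U \<in> unitary_mats k. R * E * R = U * (E * (R * R) * E) * mat_adjoint U"
proof -
  have RE: "R * E \<in> carrier_mat k k" using R E by simp
  have adj: "mat_adjoint (R * E) = E * R" using mat_adjoint_mult[OF R(1) E(1)] R E by simp
  have "R * E * (E * R) = R * (E * E) * R" "E * R * (R * E) = E * (R * R) * E"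
    using R(1) E(1) by (simp_all add: assoc_mult_mat[of _ k k _ k _ k])
  with mult_adjoint_unitarily_similar[OF RE] show ?thesis
    unfolding adj E(3) by simp
qed

theorem lemma3p4:
  fixes n m :: nat and A X B :: "complex mat"
  assumes "A \<in> psd_mats n"
    and "B \<in> psd_mats m"
    and "X \<in> carrier_mat n m"
    and "four_block_mat A X (mat_adjoint X) B \<in> psd_mats (n + m)"
  shows "\<exists>U \<in> unitary_mats (n + m). \<exists>V \<in> unitary_mats (n + m).
    four_block_mat A X (mat_adjoint X) B =
      U * four_block_mat A (0\<^sub>m n m) (0\<^sub>m m n) (0\<^sub>m m m) * mat_adjoint U
      + V * four_block_mat (0\<^sub>m n n) (0\<^sub>m n m) (0\<^sub>m m n) B * mat_adjoint V"
proof -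
  let ?k = "n + m" and ?M = "four_block_mat A X (mat_adjoint X) B"
  let ?E = "four_block_mat (1\<^sub>m n) (0\<^sub>m n m) (0\<^sub>m m n) (0\<^sub>m m m) :: complex mat"
  let ?F = "four_block_mat (0\<^sub>m n n) (0\<^sub>m n m) (0\<^sub>m m n) (1\<^sub>m m) :: complex mat"
  have A: "A \<in> carrier_mat n n" and B: "B \<in> carrier_mat m m"
    using assms(1,2) by (auto simp: psd_mats_def)
  have X: "X \<in> carrier_mat n m" "mat_adjoint X \<in> carrier_mat m n" using assms(3) by auto
  obtain R where R: "R \<in> carrier_mat ?k ?k" "mat_adjoint R = R" and M: "?M = R * R"
    using psd_mats_square_root[OF assms(4)] .
  have E: "?E \<in> carrier_mat ?k ?k" "mat_adjoint ?E = ?E" "?E * ?E = ?E"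
    by (simp, simp add: mat_adjoint_four_block[of _ n n _ m _ m])
       (subst mult_four_block_mat[where ?nc1.0 = n and ?nc2.0 = m], auto)
  have F: "?F \<in> carrier_mat ?k ?k" "mat_adjoint ?F = ?F" "?F * ?F = ?F"
    by (simp, simp add: mat_adjoint_four_block[of _ n n _ m _ m])
       (subst mult_four_block_mat[where ?nc1.0 = n and ?nc2.0 = m], auto)
  have EF: "?E + ?F = 1\<^sub>m ?k"
    by (intro eq_matI) auto
  \<comment> \<open>Multiplication by \<open>?E\<close> on the left keeps the upper block row, on
    the right the left block column; only \<open>A\<close> survives both.\<close>
  have "?E * ?M = four_block_mat A X (0\<^sub>m m n) (0\<^sub>m m m)"
    using A B X by (subst mult_four_block_mat[where ?nc1.0 = n and ?nc2.0 = m]) auto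
  then have EME: "?E * ?M * ?E = four_block_mat A (0\<^sub>m n m) (0\<^sub>m m n) (0\<^sub>m m m)"
    using A B X by (simp, subst mult_four_block_mat[where ?nc1.0 = n and ?nc2.0 = m]) auto
  have "?F * ?M = four_block_mat (0\<^sub>m n n) (0\<^sub>m n m) (mat_adjoint X) B"
    using A B X by (subst mult_four_block_mat[where ?nc1.0 = n and ?nc2.0 = m]) auto
  then have FMF: "?F * ?M * ?F = four_block_mat (0\<^sub>m n n) (0\<^sub>m n m) (0\<^sub>m m n) B"
    using A B X by (simp, subst mult_four_block_mat[where ?nc1.0 = n and ?nc2.0 = m]) auto
  \<comment> \<open>Inserting the identity as \<open>?E + ?F\<close> between the two root factors
    gives one summand for each diagonal block.\<close>
  have "?M = R * (?E + ?F) * R"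
    unfolding EF M using R by simp
  also have "\<dots> = R * ?E * R + R * ?F * R"
    using R(1) E(1) F(1)
    by (simp add: mult_add_distrib_mat[of _ ?k ?k _ ?k] add_mult_distrib_mat[of _ ?k ?k _ _ ?k])
  finally have M_sum: "?M = R * ?E * R + R * ?F * R" .
  obtain U where U: "U \<in> unitary_mats ?k" "R * ?E * R = U * (?E * ?M * ?E) * mat_adjoint U"
    using square_root_compression[OF R E, folded M] by blast
  obtain V where V: "V \<in> unitary_mats ?k" "R * ?F * R = V * (?F * ?M * ?F) * mat_adjoint V"
    using square_root_compression[OF R F, folded M] by blast
  from M_sum[unfolded U(2) V(2) EME FMF] U(1) V(1) show ?thesis by blast
qed

end
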